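(* Let $k\ge 2$ and $t\ge 2$ be integers, and let $P_1,P_2,\dots,P_k$ be posets in which every element lies in at least one $t$-chain. For $1\le i\le k$ let $n_i=|P_i|$ and let $m_i$ be the number of $t$-chains in $P_i$, where $2\le t\le n_1\le n_2\le\cdots\le n_k$ and $3\le n_k$. Let $m=\min\{m_1,m_2,\dots,m_{k-1}\}$, assume $m\ge 1$, and let $d=\binom{n_k}{t}-m_k$. Then there exists a constant $C_0>0$ depending only on $k,t,P_1,\dots,P_{k-1}$ such that, whenever a positive integer $n$ satisfies \[ \ln n<\frac{m_k}{n_k+td+2}\qquad\text{and}\qquad (\ln n)^m\, n^{n_{k-1}}<C_0\left(\frac{m_k}{n_k+td+2}\right)^m, \] then for every poset $Q$ with $n$ elements there exists a $k$-coloring of the $t$-chains of $Q$ such that, for no $i\in\{1,\dots,k\}$, $Q$ contains a monochromatic copy of $P_i$ in color $i$.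
   Context: A $t$-chain in a poset is a set of $t$ distinct pairwise comparable elements. A $k$-coloring of the $t$-chains of $Q$ assigns to each $t$-chain of $Q$ one of the colors $1,\dots,k$. A copy of a poset $P$ in $Q$ is given by an injection $f:P\to Q$ such that $f(x)\le f(y)$ in $Q$ whenever $x\le y$ in $P$ (a weak embedding); it is a monochromatic copy of $P$ in color $i$ if for every $t$-chain $C$ of $P$ the $t$-chain $f(C)$ of $Q$ has color $i$. *)

theory Defs
  imports Complex_Main
begin

text \<open>
  A poset is a relation \<open>r\<close> with \<^term>\<open>Partial_order r\<close>; its underlying set is \<^term>\<open>Field r\<close>.
  This loses nothing, since a reflexive relation on a set has that set as its field.
\<close>

text \<open>
  Members of \<^term>\<open>Chains r\<close> are pairwise comparable also with themselves, so they are subsets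
  of \<^term>\<open>Field r\<close>. The cardinality condition is meant for \<open>t > 0\<close>, where it forces finiteness.
\<close>

definition tchains :: "nat \<Rightarrow> 'a rel \<Rightarrow> 'a set set" where
  "tchains t r = {C \<in> Chains r. card C = t}"

definition weak_embedding :: "'a rel \<Rightarrow> 'b rel \<Rightarrow> ('a \<Rightarrow> 'b) \<Rightarrow> bool" where
  "weak_embedding p q f \<longleftrightarrow>
     inj_on f (Field p) \<and> f ` Field p \<subseteq> Field q \<and> (\<forall>x y. (x, y) \<in> p \<longrightarrow> (f x, f y) \<in> q)"

text \<open>Values of a coloring outside the \<open>t\<close>-chains of \<open>q\<close> are irrelevant.\<close>

definition tchain_coloring :: "nat \<Rightarrow> nat \<Rightarrow> 'a rel \<Rightarrow> ('a set \<Rightarrow> nat) \<Rightarrow> bool" where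
  "tchain_coloring k t q c \<longleftrightarrow> (\<forall>C \<in> tchains t q. c C \<in> {1..k})"

definition has_mono_copy ::
    "nat \<Rightarrow> 'a rel \<Rightarrow> 'b rel \<Rightarrow> ('b set \<Rightarrow> nat) \<Rightarrow> nat \<Rightarrow> bool" where
  "has_mono_copy t p q c i \<longleftrightarrow>
     (\<exists>f. weak_embedding p q f \<and> (\<forall>C \<in> tchains t p. c (f ` C) = i))"

end

theory Submission
  imports Defs "HOL-Library.FuncSet"
begin

text \<open>
  Color every \<open>t\<close>-chain of \<open>Q\<close> independently: color \<open>k\<close> with probability \<open>1 - p\<close>, and each
  other color with probability \<open>p / (k - 1)\<close>, where \<open>p = ln n / r\<close> and
  \<open>r = m\<^sub>k / (n\<^sub>k + t d + 2)\<close>. A weak embedding of \<open>P\<^sub>i\<close> into \<open>Q\<close> maps the \<open>m\<^sub>i\<close> \<open>t\<close>-chains of \<open>P\<^sub>i\<close>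
  to distinct \<open>t\<close>-chains, and there are at most \<open>n ^ n\<^sub>i\<close> such embeddings. The expected number of
  monochromatic copies in color \<open>k\<close> is thus at most
  \<open>n ^ n\<^sub>k * exp (- p m\<^sub>k) = n powr (- t d - 2) \<le> 1 / 4\<close> (for \<open>n \<ge> 2\<close>), and in the other colors together at most
  \<open>(k - 1) * n ^ n\<^bsub>k-1\<^esub> * p ^ m < (k - 1) * C\<^sub>0 = 1 / 2\<close>.
\<close>

section \<open>Union bound for random colorings of a finite set\<close>

lemma exists_coloring_avoiding:
  fixes w :: "'c \<Rightarrow> real"
  assumes T: "finite T" and I: "finite I" and J: "finite J"
    and S: "\<And>j. j \<in> J \<Longrightarrow> S j \<subseteq> T" and col: "\<And>j. j \<in> J \<Longrightarrow> col j \<in> I"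
    and w: "\<And>i. i \<in> I \<Longrightarrow> w i \<ge> 0" and w1: "sum w I = 1"
    and small: "(\<Sum>j\<in>J. w (col j) ^ card (S j)) < 1"
  shows "\<exists>c \<in> T \<rightarrow>\<^sub>E I. \<forall>j\<in>J. \<exists>x\<in>S j. c x \<noteq> col j"
proof (rule ccontr)
  assume neg: "\<not> ?thesis"
  \<comment> \<open>Finite sums stand in for probabilities: \<open>W\<close> is the product weight
    of a coloring, \<open>E j\<close> the event that all of \<open>S j\<close> gets color
    \<open>col j\<close>. If the claim fails, the events cover all colorings, so their weights add
    up to at least 1.\<close>
  define W where "W c = (\<Prod>x\<in>T. w (c x))" for c
  define E where "E j = (\<Pi>\<^sub>E x\<in>T. if x \<in> S j then {col j} else I)" for j
  have W_E: "sum W (E j) = w (col j) ^ card (S j)" if "j \<in> J" for j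
  proof -
    \<comment> \<open>By distributivity the sum over a product set is a product of sums; a point
      outside \<open>S j\<close> contributes the factor \<open>sum w I = 1\<close>.\<close>
    have "sum W (E j) = (\<Prod>x\<in>T. \<Sum>i\<in>(if x \<in> S j then {col j} else I). w i)"
      unfolding W_def E_def using T I by (subst prod_sum_PiE) auto
    also have "\<dots> = (\<Prod>x\<in>T. if x \<in> S j then w (col j) else 1)"
      by (intro prod.cong) (auto simp: w1)
    also have "\<dots> = (\<Prod>x\<in>T \<inter> S j. w (col j))"
      by (rule prod.inter_restrict[OF T, symmetric])
    also have "T \<inter> S j = S j"
      using S[OF that] by auto
    finally show ?thesis by simp
  qed
  have fin: "finite (T \<rightarrow>\<^sub>E I)"
    using T I by (simp add: finite_PiE)
  have E_sub: "E j \<subseteq> T \<rightarrow>\<^sub>E I" if "j \<in> J" for j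
    unfolding E_def using col[OF that] by (intro PiE_mono) auto
  have nonneg: "W c \<ge> 0" if "c \<in> T \<rightarrow>\<^sub>E I" for c
    unfolding W_def using that w by (intro prod_nonneg) auto
  have cover: "T \<rightarrow>\<^sub>E I \<subseteq> (\<Union>j\<in>J. E j)"
  proof
    fix c assume c: "c \<in> T \<rightarrow>\<^sub>E I"
    then obtain j where j: "j \<in> J" "\<forall>x\<in>S j. c x = col j"
      using neg by blast
    then have "c \<in> E j"
      using c by (auto simp: E_def PiE_iff)
    then show "c \<in> (\<Union>j\<in>J. E j)"
      using j by blast
  qed
  have "1 = (\<Prod>x\<in>T. sum w I)"
    by (simp add: w1)
  also have "\<dots> = sum W (T \<rightarrow>\<^sub>E I)"
    unfolding W_def using T I by (subst prod_sum_PiE) auto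
  also have "\<dots> \<le> sum W (\<Union>j\<in>J. E j)"
    using cover E_sub fin J nonneg by (intro sum_mono2) (auto intro: finite_subset)
  also have "\<dots> \<le> (\<Sum>j\<in>J. sum W (E j))"
  proof -
    \<comment> \<open>The overlap dropped at each step has nonnegative weight;
      \<open>A \<subseteq> J\<close> keeps the events where \<open>nonneg\<close> applies.\<close>
    have "sum W (\<Union>j\<in>A. E j) \<le> (\<Sum>j\<in>A. sum W (E j))" if "finite A" "A \<subseteq> J" for A
      using that
    proof (induction A rule: finite_induct)
      case (insert a A)
      have fa: "finite (E a)" and fA: "finite (\<Union>j\<in>A. E j)"
        using insert E_sub fin by (auto intro: finite_subset)
      have "sum W (E a \<inter> (\<Union>j\<in>A. E j)) \<ge> 0"
        using E_sub nonneg insert.prems by (intro sum_nonneg) blast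
      then have "sum W (E a \<union> (\<Union>j\<in>A. E j)) \<le> sum W (E a) + sum W (\<Union>j\<in>A. E j)"
        using sum_Un[OF fa fA, of W] by simp
      then show ?case
        using insert by simp
    qed simp
    then show ?thesis
      using J by simp
  qed
  also have "\<dots> = (\<Sum>j\<in>J. w (col j) ^ card (S j))"
    using W_E by simp
  finally show False
    using small by simp
qed

section \<open>Chains and their images under weak embeddings\<close>

lemma tchains_subset_Field: "C \<in> tchains t r \<Longrightarrow> C \<subseteq> Field r"
  by (auto simp: tchains_def Chains_def Field_def)

lemma finite_tchains: "finite (Field r) \<Longrightarrow> finite (tchains t r)"
  by (rule finite_subset[of _ "Pow (Field r)"]) (use tchains_subset_Field in auto)

lemma card_tchains_le_binomial:
  assumes "finite (Field r)"
  shows "card (tchains t r) \<le> card (Field r) choose t"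
proof -
  have "card (tchains t r) \<le> card {C. C \<subseteq> Field r \<and> card C = t}"
    using assms tchains_subset_Field by (intro card_mono) (auto simp: tchains_def)
  then show ?thesis
    using assms by (simp add: n_subsets)
qed

lemma weak_embedding_image_tchain:
  assumes f: "weak_embedding p q f" and C: "C \<in> tchains t p"
  shows "f ` C \<in> tchains t q"
proof -
  have "inj_on f C"
    using f tchains_subset_Field[OF C] by (auto simp: weak_embedding_def intro: inj_on_subset)
  then show ?thesis
    using f C by (simp add: tchains_def Chains_def weak_embedding_def card_image) blast
qed

text \<open>Taking images is injective on subsets of the field. Hence a copy prescribes the color of
  as many chains as \<open>p\<close> has, and this number is the exponent in the weight of its
  event.\<close>

lemma card_image_tchains:
  assumes "inj_on f (Field p)"
  shows "card ((`) f ` tchains t p) = card (tchains t p)"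
  by (intro card_image inj_on_subset[OF inj_on_image_Pow[OF assms]])
    (auto dest: tchains_subset_Field)

lemma weak_embedding_card_le:
  assumes "weak_embedding p q f" "finite (Field q)"
  shows "card (Field p) \<le> card (Field q)"
  using assms by (auto simp: weak_embedding_def intro: card_inj_on_le)

text \<open>Allows passing from an embedding to its restriction to the field, so that embeddings can
  be counted as extensional functions.\<close>

lemma weak_embedding_cong:
  assumes "\<And>x. x \<in> Field p \<Longrightarrow> f x = g x"
  shows "weak_embedding p q f \<longleftrightarrow> weak_embedding p q g"
proof -
  have "inj_on f (Field p) \<longleftrightarrow> inj_on g (Field p)"
    by (intro inj_on_cong assms)
  moreover have "f ` Field p = g ` Field p"
    using assms by (intro image_cong) auto
  moreover have "f x = g x \<and> f y = g y" if "(x, y) \<in> p" for x y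
    using assms that by (auto simp: Field_def)
  ultimately show ?thesis
    by (auto simp: weak_embedding_def)
qed

section \<open>First moment bound for monochromatic copies\<close>

lemma exists_tchain_coloring_without_mono_copy:
  fixes P :: "nat \<Rightarrow> 'a rel" and Q :: "'b rel" and w :: "nat \<Rightarrow> real"
  assumes P: "\<And>i. i \<in> {1..k} \<Longrightarrow> finite (Field (P i))" and Q: "finite (Field Q)"
    and w: "\<And>i. i \<in> {1..k} \<Longrightarrow> w i \<ge> 0" and w1: "sum w {1..k} = 1"
    and small: "(\<Sum>i\<in>{1..k}.
      real (card (Field Q)) ^ card (Field (P i)) * w i ^ card (tchains t (P i))) < 1"
  shows "\<exists>c. tchain_coloring k t Q c \<and> (\<forall>i\<in>{1..k}. \<not> has_mono_copy t (P i) Q c i)"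
proof -
  define F where "F i = {f \<in> Field (P i) \<rightarrow>\<^sub>E Field Q. weak_embedding (P i) Q f}" for i
  \<comment> \<open>One bad event for each color and each extensional embedding of the corresponding
    poset.\<close>
  define J where "J = (SIGMA i:{1..k}. F i)"
  define S where "S j = (`) (snd j) ` tchains t (P (fst j))" for j :: "nat \<times> ('a \<Rightarrow> 'b)"
  have finE: "finite (Field (P i) \<rightarrow>\<^sub>E Field Q)" if "i \<in> {1..k}" for i
    using P[OF that] Q by (simp add: finite_PiE)
  then have finF: "finite (F i)" if "i \<in> {1..k}" for i
    using that by (simp add: F_def)
  have cardF: "card (F i) \<le> card (Field Q) ^ card (Field (P i))" if "i \<in> {1..k}" for i
  proof -
    have "card (F i) \<le> card (Field (P i) \<rightarrow>\<^sub>E Field Q)"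
      using finE[OF that] by (intro card_mono) (auto simp: F_def)
    then show ?thesis
      using P[OF that] by (simp add: card_funcsetE)
  qed
  have cardS: "card (S (i, f)) = card (tchains t (P i))" if "f \<in> F i" for i f
    using that card_image_tchains by (auto simp: S_def F_def weak_embedding_def)
  have "(\<Sum>j\<in>J. w (fst j) ^ card (S j)) = (\<Sum>i\<in>{1..k}. \<Sum>f\<in>F i. w i ^ card (S (i, f)))"
    unfolding J_def using finF by (subst sum.Sigma) (auto simp: case_prod_unfold)
  also have "\<dots> = (\<Sum>i\<in>{1..k}. real (card (F i)) * w i ^ card (tchains t (P i)))"
    using cardS by simp
  also have "\<dots> \<le> (\<Sum>i\<in>{1..k}.
      real (card (Field Q)) ^ card (Field (P i)) * w i ^ card (tchains t (P i)))"
  proof (intro sum_mono mult_right_mono)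
    fix i assume i: "i \<in> {1..k}"
    show "real (card (F i)) \<le> real (card (Field Q)) ^ card (Field (P i))"
      using cardF[OF i] by (metis of_nat_le_iff of_nat_power)
  qed (use w in auto)
  finally have small': "(\<Sum>j\<in>J. w (fst j) ^ card (S j)) < 1"
    using small by simp
  have "\<exists>c\<in>tchains t Q \<rightarrow>\<^sub>E {1..k}. \<forall>j\<in>J. \<exists>x\<in>S j. c x \<noteq> fst j"
  proof (rule exists_coloring_avoiding)
    show "S j \<subseteq> tchains t Q" if "j \<in> J" for j
      using that weak_embedding_image_tchain by (auto simp: J_def F_def S_def)
  qed (use finite_tchains[OF Q] finF w w1 small' in \<open>auto simp: J_def\<close>)
  then obtain c where c: "c \<in> tchains t Q \<rightarrow>\<^sub>E {1..k}"
    and avoid: "\<And>j. j \<in> J \<Longrightarrow> \<exists>x\<in>S j. c x \<noteq> fst j"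
    by blast
  have "\<not> has_mono_copy t (P i) Q c i" if i: "i \<in> {1..k}" for i
  proof
    assume "has_mono_copy t (P i) Q c i"
    then obtain f where f: "weak_embedding (P i) Q f"
      and mono: "\<And>C. C \<in> tchains t (P i) \<Longrightarrow> c (f ` C) = i"
      by (auto simp: has_mono_copy_def)
    \<comment> \<open>Restriction discards the arbitrary values of \<open>f\<close> outside the
      field but keeps the images of chains.\<close>
    define g where "g = restrict f (Field (P i))"
    have "weak_embedding (P i) Q g"
      using f weak_embedding_cong[of "P i" g f Q] by (simp add: g_def)
    then have "(i, g) \<in> J"
      using i by (auto simp: J_def F_def g_def weak_embedding_def)
    then obtain C where C: "C \<in> tchains t (P i)" "c (g ` C) \<noteq> i"
      using avoid by (force simp: S_def)
    moreover have "g ` C = f ` C"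
      using tchains_subset_Field[OF C(1)] by (auto simp: g_def intro!: image_cong)
    ultimately show False
      using mono by simp
  qed
  moreover have "tchain_coloring k t Q c"
    using c by (auto simp: tchain_coloring_def PiE_iff)
  ultimately show ?thesis by blast
qed

text \<open>The last poset is quantified as \<open>Pk\<close> after \<open>C0\<close> and inserted
  by \<open>P(k := Pk)\<close>; this order of quantifiers expresses that \<open>C0\<close> may
  depend only on \<open>k\<close>, \<open>t\<close> and the earlier posets.\<close>

theorem theorem2p1:
  fixes k t m :: nat and P :: "nat \<Rightarrow> 'a rel"
  assumes "k \<ge> 2" and "t \<ge> 2"
    and "\<And>i. i \<in> {1..<k} \<Longrightarrow> Partial_order (P i)"
    and "\<And>i. i \<in> {1..<k} \<Longrightarrow> finite (Field (P i))"
    and "\<And>i. i \<in> {1..<k} \<Longrightarrow> \<forall>x \<in> Field (P i). \<exists>C \<in> tchains t (P i). x \<in> C"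
    and "t \<le> card (Field (P 1))"
    and "\<And>i j. 1 \<le> i \<Longrightarrow> i \<le> j \<Longrightarrow> j < k \<Longrightarrow> card (Field (P i)) \<le> card (Field (P j))"
    and "m = Min ((\<lambda>i. card (tchains t (P i))) ` {1..<k})"
    and "m \<ge> 1"
  shows "\<exists>C0 > (0::real). \<forall>Pk :: 'a rel.
    Partial_order Pk \<longrightarrow> finite (Field Pk) \<longrightarrow>
    (\<forall>x \<in> Field Pk. \<exists>C \<in> tchains t Pk. x \<in> C) \<longrightarrow>
    card (Field (P (k - 1))) \<le> card (Field Pk) \<longrightarrow> 3 \<le> card (Field Pk) \<longrightarrow>
    (let nk = card (Field Pk);
         mk = card (tchains t Pk);
         d = real (nk choose t) - real mk;
         r = real mk / (real nk + real t * d + 2)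
     in \<forall>n :: nat. n > 0 \<longrightarrow>
          ln (real n) < r \<longrightarrow>
          ln (real n) ^ m * real n ^ card (Field (P (k - 1))) < C0 * r ^ m \<longrightarrow>
          (\<forall>Q :: 'b rel. Partial_order Q \<longrightarrow> card (Field Q) = n \<longrightarrow>
             (\<exists>c. tchain_coloring k t Q c \<and>
                  (\<forall>i \<in> {1..k}. \<not> has_mono_copy t ((P(k := Pk)) i) Q c i))))"
proof (intro exI[of _ "1 / (2 * real (k - 1))"] conjI allI impI)
  show "0 < 1 / (2 * real (k - 1))"
    using assms(1) by simp
next
  fix Pk :: "'a rel"
  assume Pk: "finite (Field Pk)"
    and Pk_chain: "\<forall>x\<in>Field Pk. \<exists>C\<in>tchains t Pk. x \<in> C"
    and Pk3: "3 \<le> card (Field Pk)"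
  define N where "N = card (Field (P (k - 1)))"
  define nk where "nk = card (Field Pk)"
  define mk where "mk = card (tchains t Pk)"
  define d where "d = real (nk choose t) - real mk"
  define r where "r = real mk / (real nk + real t * d + 2)"
  let ?P = "P(k := Pk)"
  have "Field Pk \<noteq> {}"
    using Pk3 by auto
  then have mk: "mk > 0"
    using Pk_chain finite_tchains[OF Pk, of t] by (auto simp: mk_def card_gt_0_iff)
  have d: "d \<ge> 0"
    using card_tchains_le_binomial[OF Pk, of t] by (simp add: d_def nk_def mk_def)
  have den: "real nk + real t * d + 2 > 0"
    using d by (intro add_nonneg_pos add_nonneg_nonneg) auto
  have r: "r > 0"
    using mk den by (simp add: r_def)
  have main: "\<exists>c. tchain_coloring k t Q c \<and> (\<forall>i\<in>{1..k}. \<not> has_mono_copy t (?P i) Q c i)"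
    if n: "n > 0" and lnr: "ln (real n) < r"
      and small: "ln (real n) ^ m * real n ^ N < 1 / (2 * real (k - 1)) * r ^ m"
      and Q: "card (Field Q) = n"
    for n :: nat and Q :: "'b rel"
  proof (cases "n = 1")
    case True
    \<comment> \<open>\<open>card\<close> is 0 on infinite sets, so \<open>n > 0\<close> gives
      finiteness. For \<open>n = 1\<close> the bound \<open>1 / n ^ 2\<close> would be useless, but
      each poset has at least two elements and cannot embed.\<close>
    have finQ: "finite (Field Q)"
      using Q n by (auto intro: card_ge_0_finite)
    have "card (Field (?P i)) > 1" if "i \<in> {1..k}" for i
      using that assms(2,6) assms(7)[of 1 i] Pk3 by (cases "i = k") auto
    then have "\<not> has_mono_copy t (?P i) Q c i" if "i \<in> {1..k}" for i c
      using that weak_embedding_card_le[OF _ finQ, of "?P i"] Q True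
      unfolding has_mono_copy_def by (metis not_le)
    moreover have "tchain_coloring k t Q (\<lambda>_. 1)"
      using assms(1) by (simp add: tchain_coloring_def)
    ultimately show ?thesis by blast
  next
    case False
    then have n2: "n \<ge> 2"
      using n by simp
    have finQ: "finite (Field Q)"
      using Q n by (auto intro: card_ge_0_finite)
    define p where "p = ln (real n) / r"
    have p0: "p \<ge> 0"
      using n r by (simp add: p_def)
    have p1: "p < 1"
      using lnr r by (simp add: p_def)
    define w where "w i = (if i = k then 1 - p else p / real (k - 1))" for i
    have split: "{1..k} = insert k {1..<k}"
      using assms(1) by auto
    have w1: "sum w {1..k} = 1"
      unfolding split using assms(1) by (simp add: w_def)
    have w_le: "w i \<le> p" if "i \<in> {1..<k}" for i
      using that assms(1) p0 by (simp add: w_def divide_le_eq mult_le_cancel_left1)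
    have w0: "w i \<ge> 0" for i
      using p0 p1 by (simp add: w_def)
    define X where "X i =
      real (card (Field Q)) ^ card (Field (?P i)) * w i ^ card (tchains t (?P i))" for i
    \<comment> \<open>As \<open>w i \<le> p < 1\<close>, lowering the exponent to the minimum
      \<open>m\<close> only increases the weight; as \<open>n \<ge> 1\<close>, so does raising the
      other exponent to \<open>N\<close>, the largest size below \<open>k\<close>.\<close>
    have X_less: "X i \<le> real n ^ N * p ^ m" if i: "i \<in> {1..<k}" for i
    proof -
      have "m \<le> card (tchains t (P i))"
        using i unfolding assms(8) by (intro Min_le) auto
      then have "w i ^ card (tchains t (P i)) \<le> p ^ m"
        using power_mono[OF w_le[OF i] w0] power_decreasing[of m _ p] p0 p1
        by (meson less_imp_le order_trans)
      moreover have "real n ^ card (Field (P i)) \<le> real n ^ N"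
        using i n2 assms(7)[of i "k - 1"] by (intro power_increasing) (auto simp: N_def)
      ultimately show ?thesis
        using i w0 Q unfolding X_def by (auto intro!: mult_mono)
    qed
    have "real n ^ N * p ^ m < 1 / (2 * real (k - 1))"
      using small r by (simp add: p_def power_divide divide_less_eq mult.commute)
    then have "real (k - 1) * (real n ^ N * p ^ m) < 1 / 2"
      using assms(1) by (simp add: field_simps)
    moreover have "sum X {1..<k} \<le> real (k - 1) * (real n ^ N * p ^ m)"
      using sum_bounded_above[OF X_less, of "{1..<k}"] by simp
    moreover have "X k \<le> 1 / 4"
    proof -
      have "p * real mk = ln (real n) * (real nk + real t * d + 2)"
        using mk den by (simp add: p_def r_def)
      then have "exp (- p) ^ mk = exp (- (ln (real n) * (real nk + real t * d + 2)))"
        by (simp add: exp_of_nat_mult[symmetric] mult.commute)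
      \<comment> \<open>Only \<open>nk + 2\<close> of the denominator of \<open>r\<close> is kept:
        \<open>nk\<close> cancels the number of embeddings and 2 leaves
        \<open>1 / n ^ 2\<close>.\<close>
      also have "\<dots> \<le> exp (- (ln (real n) * (real nk + 2)))"
        using d n by (simp add: mult_left_mono)
      also have "\<dots> = inverse (real n ^ (nk + 2))"
      proof -
        have "ln (real n) * (real nk + 2) = ln (real n ^ (nk + 2))"
          using n by (subst ln_realpow) (simp_all add: mult.commute)
        then show ?thesis
          using n by (simp only: exp_minus) simp
      qed
      finally have "exp (- p) ^ mk \<le> inverse (real n ^ (nk + 2))" .
      moreover have "(1 - p) ^ mk \<le> exp (- p) ^ mk"
        using p1 exp_ge_add_one_self[of "- p"] by (intro power_mono) auto
      ultimately have "(1 - p) ^ mk \<le> inverse (real n ^ (nk + 2))"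
        by simp
      then have "real n ^ nk * (1 - p) ^ mk \<le> real n ^ nk * inverse (real n ^ (nk + 2))"
        by (intro mult_left_mono) auto
      also have "\<dots> = 1 / real n ^ 2"
        using n by (simp add: power_add power2_eq_square field_simps)
      also have "\<dots> \<le> 1 / 2 ^ 2"
        using n2 by (intro divide_left_mono power_mono) auto
      finally show ?thesis
        using Q by (simp add: X_def w_def nk_def mk_def)
    qed
    ultimately have "sum X {1..k} < 1"
      unfolding split by simp
    then show ?thesis
      using assms(4) Pk finQ w0 w1 unfolding X_def
      by (intro exists_tchain_coloring_without_mono_copy) auto
  qed
  show "let nk = card (Field Pk); mk = card (tchains t Pk);
      d = real (nk choose t) - real mk; r = real mk / (real nk + real t * d + 2)
    in \<forall>n>0. ln (real n) < r \<longrightarrow>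
      ln (real n) ^ m * real n ^ card (Field (P (k - 1))) < 1 / (2 * real (k - 1)) * r ^ m \<longrightarrow>
      (\<forall>Q :: 'b rel. Partial_order Q \<longrightarrow> card (Field Q) = n \<longrightarrow>
        (\<exists>c. tchain_coloring k t Q c \<and> (\<forall>i\<in>{1..k}. \<not> has_mono_copy t (?P i) Q c i)))"
    using main unfolding Let_def r_def d_def mk_def nk_def N_def by blast
qed

end
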